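(* For $n\ge 0$ let $B_n(Y_0,Y_1,Z)$ be the polynomials defined by the identity of formal power series in $u$ $$\sum_{n\ge 0}\frac{u^n}{n!}B_n(Y_0,Y_1,Z)=\bigl(1-u(1+Z)\bigr)^{-1}\times\frac{\exp\bigl(u(Y_0+Y_1Z)\bigr)}{\exp\bigl(u(1+Z)\bigr)}.$$ Then for every $n\ge 0$, $$B_n(Y_0,Y_1,Z)=\sum_{w\in B_n}Y_1^{\mathrm{fix}^-w}\,Y_0^{\mathrm{fix}^+w}\,Z^{\mathrm{neg}\,w}=\sum_{w\in B_n}Y_1^{\mathrm{pix}^-w}\,Y_0^{\mathrm{pix}^+w}\,Z^{\mathrm{neg}\,w}.$$
   Context: $B_n$ (the hyperoctahedral group) is the set of signed permutations of order $n$: words $w=x_1x_2\cdots x_n$ with each $x_i\in\{-n,\dots,-1,1,\dots,n\}$ such that $|x_1||x_2|\cdots|x_n|$ is a permutation of $12\cdots n$. $\mathrm{neg}\,w$ is the number of negative letters of $w$. A positive fixed point of $w$ is a positive integer $i$ with $x_i=i$; a negative fixed point is $-i$ with $i>0$ and $x_i=-i$; $\mathrm{fix}^+w$ and $\mathrm{fix}^-w$ are the numbers of positive and negative fixed points. A word $x_1\cdots x_m$ of distinct integers is a desarrangement if there is $k\ge1$ with $x_1>x_2>\cdots>x_{2k}$ and $x_{2k}<x_{2k+1}$, with the convention $x_{m+1}=\infty$ (so no one-letter word is a desarrangement); the empty word is also a desarrangement. Every $w\in B_n$ has a unique factorization $w=w^-w^+w^d$ (pixed factorization), where $w^d$ is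 the longest right factor of $w$ that is a desarrangement, $w^-$ is an increasing word all of whose letters are negative and $w^+$ is an increasing word all of whose letters are positive. $\mathrm{pix}^-w$ and $\mathrm{pix}^+w$ are the lengths of $w^-$ and $w^+$. *)

theory Defs
  imports
    "HOL-Computational_Algebra.Computational_Algebra"
    "HOL-Combinatorics.Multiset_Permutations"
    "HOL-Library.Sublist"
begin

section \<open>Signed permutations\<close>

definition signed_perms :: "nat \<Rightarrow> int list set" where
  "signed_perms n =
     {w. set w \<subseteq> {- int n..-1} \<union> {1..int n} \<and> map abs w \<in> permutations_of_set {1..int n}}"

definition neg :: "int list \<Rightarrow> nat" where
  "neg w = length (filter (\<lambda>x. x < 0) w)"

text \<open>Positions of words are counted from 1, those of lists from 0.\<close>

definition fix_plus :: "int list \<Rightarrow> nat" where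
  "fix_plus w = card {i \<in> {1..length w}. w ! (i - 1) = int i}"

definition fix_minus :: "int list \<Rightarrow> nat" where
  "fix_minus w = card {i \<in> {1..length w}. w ! (i - 1) = - int i}"


section \<open>Desarrangements and the pixed factorization\<close>

text \<open>The letter \<open>x\<^sub>i\<close> is \<open>xs ! (i - 1)\<close>. The guard on the last inequality is the convention
  \<open>x\<^sub>m\<^sub>+\<^sub>1 = \<infinity>\<close>, where \<open>m\<close> is the length of \<open>xs\<close>; as \<open>x\<^sub>m\<^sub>+\<^sub>1\<close> is not a letter, \<open>2 * k \<le> m\<close>.\<close>

definition desarrangement :: "int list \<Rightarrow> bool" where
  "desarrangement xs \<longleftrightarrow> distinct xs \<and>
     (xs = [] \<or>
      (\<exists>k\<ge>1. 2 * k \<le> length xs \<and>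
         (\<forall>i\<in>{1..<2 * k}. xs ! (i - 1) > xs ! i) \<and>
         (2 * k < length xs \<longrightarrow> xs ! (2 * k - 1) < xs ! (2 * k))))"

definition longest_desarrangement_suffix :: "int list \<Rightarrow> int list \<Rightarrow> bool" where
  "longest_desarrangement_suffix w d \<longleftrightarrow>
     suffix d w \<and> desarrangement d \<and>
     (\<forall>d'. suffix d' w \<and> desarrangement d' \<longrightarrow> length d' \<le> length d)"

definition is_pixed_factorization ::
    "int list \<Rightarrow> int list \<times> int list \<times> int list \<Rightarrow> bool" where
  "is_pixed_factorization w = (\<lambda>(wm, wp, wd).
     w = wm @ wp @ wd \<and> longest_desarrangement_suffix w wd \<and>
     sorted_wrt (<) wm \<and> (\<forall>x\<in>set wm. x < 0) \<and>
     sorted_wrt (<) wp \<and> (\<forall>x\<in>set wp. x > 0))"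

definition pixed_factorization :: "int list \<Rightarrow> int list \<times> int list \<times> int list" where
  "pixed_factorization w = (THE f. is_pixed_factorization w f)"

definition pix_minus :: "int list \<Rightarrow> nat" where
  "pix_minus w = (case pixed_factorization w of (wm, wp, wd) \<Rightarrow> length wm)"

definition pix_plus :: "int list \<Rightarrow> nat" where
  "pix_plus w = (case pixed_factorization w of (wm, wp, wd) \<Rightarrow> length wp)"

lemma desarrangement_Nil: "desarrangement []"
  by (simp add: desarrangement_def)

lemma desarrangement_Cons2:
  assumes "distinct (x # y # d)" "x > y" "desarrangement d"
  shows "desarrangement (x # y # d)"
proof (cases "d = [] \<or> y < hd d")
  case True
  then show ?thesis using assms unfolding desarrangement_def
    by (intro conjI disjI2 exI[of _ 1]) (auto simp: neq_Nil_conv)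
next
  case False
  then obtain k where k: "k \<ge> 1" "2 * k \<le> length d" "\<forall>i\<in>{1..<2 * k}. d ! (i - 1) > d ! i"
    "2 * k < length d \<longrightarrow> d ! (2 * k - 1) < d ! (2 * k)"
    using assms(3) unfolding desarrangement_def by blast
  have "hd d \<noteq> y" using False assms(1) by (cases d) auto
  then have yd: "y > d ! 0" using False by (cases d) auto
  have "(x # y # d) ! (i - 1) > (x # y # d) ! i" if "i \<in> {1..<2 * Suc k}" for i
  proof -
    have "i = 1 \<or> i = 2 \<or> i = Suc (Suc (i - 2)) \<and> i - 2 \<ge> 1" using that by auto
    then consider "i = 1" | "i = 2" | j where "i = Suc (Suc j)" "j \<ge> 1" by blast
    then show ?thesis
    proof cases
      case 3
      then have "d ! (j - 1) > d ! j" using k(3) that by auto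
      then show ?thesis using 3 by (cases j) auto
    qed (use assms yd in auto)
  qed
  moreover have "(x # y # d) ! (2 * Suc k - 1) < (x # y # d) ! (2 * Suc k)"
    if "2 * Suc k < length (x # y # d)"
    using k(1,4) that by (cases "2 * k") auto
  ultimately show ?thesis using assms k(2) unfolding desarrangement_def
    by (intro conjI disjI2 exI[of _ "Suc k"]) auto
qed

lemma longest_desarrangement_suffix_ex: "\<exists>d. longest_desarrangement_suffix w d"
proof -
  have "\<exists>d. (suffix d w \<and> desarrangement d) \<and>
      (\<forall>d'. suffix d' w \<and> desarrangement d' \<longrightarrow> length d' \<le> length d)"
    by (rule ex_has_greatest_nat[where k = "[]" and b = "Suc (length w)"])
       (auto simp: desarrangement_Nil dest: suffix_length_le)
  then show ?thesis unfolding longest_desarrangement_suffix_def by blast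
qed

lemma prefix_increasing:
  assumes "distinct (p @ d)" "longest_desarrangement_suffix (p @ d) d"
  shows "sorted_wrt (<) p"
proof (rule ccontr)
  assume "\<not> ?thesis"
  have "\<exists>q r s. p = q @ r # s \<and> \<not> sorted_wrt (<) (r # s) \<and> sorted_wrt (<) s"
    using \<open>\<not> sorted_wrt (<) p\<close>
  proof (induction p)
    case (Cons a p)
    then show ?case by (metis append_Cons append_Nil)
  qed simp
  then obtain q x s where p: "p = q @ x # s" "\<not> sorted_wrt (<) (x # s)" "sorted_wrt (<) s"
    by blast
  then obtain y t where s: "s = y # t" by (cases s) auto
  have xy: "x > y" using p s assms(1) by fastforce
  have dis: "distinct (x # y # t @ d)" using assms(1) p s by auto
  have "desarrangement (x # y # t @ d)"
  proof (cases t)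
    case Nil
    then show ?thesis using desarrangement_Cons2[of x y d] xy dis assms(2)
      by (auto simp: longest_desarrangement_suffix_def)
  next
    case (Cons z u)
    then have "y < z" using p s by simp
    then show ?thesis using dis xy Cons unfolding desarrangement_def
      by (intro conjI disjI2 exI[of _ 1]) auto
  qed
  moreover have "suffix (x # y # t @ d) (p @ d)" unfolding p s by (auto simp: suffix_def)
  ultimately show False using assms(2) unfolding longest_desarrangement_suffix_def by force
qed

lemma pixed_factorization_unique_exists:
  assumes "w \<in> signed_perms n"
  shows "\<exists>!f. is_pixed_factorization w f"
proof (rule ex_ex1I)
  have dist: "distinct w" and nz: "0 \<notin> set w"
    using assms by (auto simp: signed_perms_def permutations_of_set_def distinct_map)
  obtain d where d: "longest_desarrangement_suffix w d"
    using longest_desarrangement_suffix_ex by blast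
  then obtain p where w: "w = p @ d" unfolding longest_desarrangement_suffix_def suffix_def by blast
  have inc: "sorted_wrt (<) p" using prefix_increasing dist d w by blast
  define a where "a = takeWhile (\<lambda>x. x < 0) p"
  define b where "b = dropWhile (\<lambda>x. x < 0) p"
  have ab: "p = a @ b" by (simp add: a_def b_def)
  have "x > 0" if x: "x \<in> set b" for x
  proof -
    obtain h c where b: "b = h # c" using x by (cases b) auto
    then have "\<not> h < 0" unfolding b_def using hd_dropWhile[of "\<lambda>x. x < 0" p] by fastforce
    moreover have "h \<noteq> 0" using nz w ab b by auto
    moreover have "h \<le> x" using x inc ab b by (auto simp: sorted_wrt_append)
    ultimately show ?thesis by linarith
  qed
  moreover have "\<forall>x\<in>set a. x < 0" unfolding a_def by (auto dest: set_takeWhileD)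
  ultimately have "is_pixed_factorization w (a, b, d)"
    using inc d w unfolding is_pixed_factorization_def ab case_prod_conv sorted_wrt_append append_assoc
    by blast
  then show "\<exists>f. is_pixed_factorization w f" by blast
next
  fix f g assume fg: "is_pixed_factorization w f" "is_pixed_factorization w g"
  obtain a b c a' b' c' where e: "f = (a, b, c)" "g = (a', b', c')" by (metis prod_cases3)
  have "length c = length c'" using fg unfolding e is_pixed_factorization_def
      longest_desarrangement_suffix_def case_prod_conv by (intro le_antisym) blast+
  moreover have "(a @ b) @ c = (a' @ b') @ c'"
    using fg unfolding e is_pixed_factorization_def case_prod_conv append_assoc by metis
  ultimately have *: "a @ b = a' @ b'" "c = c'" using append_eq_append_conv by blast+
  have tw: "takeWhile (\<lambda>x. x < 0) (v @ v') = v"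
    if "\<forall>x\<in>set v. x < 0" "\<forall>x\<in>set v'. x > 0" for v v' :: "int list"
    using that by (cases v') auto
  have "a = takeWhile (\<lambda>x. x < 0) (a @ b)" "a' = takeWhile (\<lambda>x. x < 0) (a' @ b')"
    using fg tw[of a b] tw[of a' b'] unfolding e is_pixed_factorization_def case_prod_conv by metis+
  then have "a = a'" using * by simp
  then show "f = g" unfolding e using * by simp
qed


section \<open>The generating function\<close>

text \<open>The ring \<open>\<rat>[Y\<^sub>0, Y\<^sub>1, Z]\<close> and its field of fractions, over which \<^const>\<open>fps_exp\<close> and division
  of power series are available. The series variable \<open>u\<close> is \<^const>\<open>fps_X\<close>, and \<open>exp (c u)\<close> is
  \<open>fps_exp c\<close>.\<close>

type_synonym poly3 = "rat poly poly poly"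

definition var_Y0 :: poly3 where "var_Y0 = [:[:[:0, 1:]:]:]"
definition var_Y1 :: poly3 where "var_Y1 = [:[:0, 1:]:]"
definition var_Z :: poly3 where "var_Z = [:0, 1:]"

definition gen_fun :: "poly3 fract fps" where
  "gen_fun =
     inverse (1 - fps_X * fps_const (to_fract (1 + var_Z))) *
     (fps_exp (to_fract (var_Y0 + var_Y1 * var_Z)) / fps_exp (to_fract (1 + var_Z)))"

text \<open>The coefficients of the series times \<open>n!\<close> are indeed polynomials, so the identity
  defines them.\<close>

definition fract_fps :: "poly3 fps \<Rightarrow> poly3 fract fps" where
  "fract_fps G = Abs_fps (\<lambda>n. to_fract (G $ n))"

lemma fract_fps_mult: "fract_fps (G * H) = fract_fps G * fract_fps H"
  by (simp add: fract_fps_def fps_eq_iff fps_mult_nth to_fract_sum)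

lemma to_fract_of_nat: "to_fract (of_nat n) = of_nat n"
  by (induction n) auto

lemma to_fract_power: "to_fract (a ^ n) = to_fract a ^ n"
  by (induction n) auto

lemma to_fract_fact: "to_fract (fact n) = fact n"
  by (metis of_nat_fact to_fract_of_nat)

lemma fact_poly: "(fact n :: 'a::{comm_ring_1,ring_char_0} poly) = [:fact n:]"
  by (metis of_nat_fact of_nat_poly)

lemma fps_exp_to_fract:
  "fps_exp (to_fract a) = fract_fps (Abs_fps (\<lambda>n. [:[:[:1 / fact n:]:]:] * a ^ n))"
proof -
  have c: "[:[:[:1 / fact n:]:]:] * (fact n :: poly3) = 1" for n
    unfolding fact_poly by (simp add: one_pCons)
  have "to_fract [:[:[:1 / fact n:]:]:] = (1 / fact n :: poly3 fract)" for n
  proof -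
    have "to_fract [:[:[:1 / fact n:]:]:] * (fact n :: poly3 fract) = 1"
      by (metis c to_fract_mult to_fract_fact to_fract_1)
    then show ?thesis by (metis fact_nonzero nonzero_eq_divide_eq)
  qed
  then have "to_fract ([:[:[:1 / fact n:]:]:] * a ^ n) = to_fract a ^ n / fact n" for n
    by (simp only: to_fract_mult to_fract_power times_divide_eq_left mult_1)
  then show ?thesis
    unfolding fract_fps_def fps_eq_iff by (simp only: fps_nth_Abs_fps fps_exp_nth of_nat_fact simp_thms)
qed

lemma gen_fun_eq_fract_fps: "\<exists>G. gen_fun = fract_fps G"
proof -
  have "inverse (1 - fps_X * fps_const c) = Abs_fps (\<lambda>n. c ^ n)" for c :: "poly3 fract"
  proof -
    have "(1 - fps_X * fps_const c) * Abs_fps (\<lambda>n. c ^ n) = 1"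
    proof (rule fps_ext)
      fix n
      show "((1 - fps_X * fps_const c) * Abs_fps (\<lambda>n. c ^ n)) $ n = 1 $ n"
        by (cases n) (simp_all add: algebra_simps)
    qed
    then show ?thesis by (rule fps_inverse_unique)
  qed
  then have "inverse (1 - fps_X * fps_const (to_fract (1 + var_Z))) =
      fract_fps (Abs_fps (\<lambda>n. (1 + var_Z) ^ n))"
    by (simp add: fract_fps_def to_fract_power)
  moreover have "fps_exp a / fps_exp b = fps_exp (a - b)" for a b :: "poly3 fract"
    using fps_exp_add_mult[of a "- b"] by (simp add: fps_divide_unit fps_exp_neg)
  then have "fps_exp (to_fract a) / fps_exp (to_fract b) = fps_exp (to_fract (a - b))" for a b :: poly3
    by simp
  ultimately show ?thesis
    unfolding gen_fun_def fps_exp_to_fract by (simp flip: fract_fps_mult) blast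
qed

lemma gen_fun_unique_exists:
  "\<exists>!B. Abs_fps (\<lambda>n. to_fract (B n) / fact n) = gen_fun"
proof -
  obtain G where G: "gen_fun = fract_fps G" using gen_fun_eq_fract_fps by blast
  have eq: "Abs_fps (\<lambda>n. to_fract (B n) / fact n) = gen_fun \<longleftrightarrow> B = (\<lambda>n. fact n * G $ n)" for B
  proof -
    have "to_fract (B n) / fact n = to_fract (G $ n) \<longleftrightarrow> B n = fact n * G $ n" for n
    proof -
      have "to_fract (B n) / fact n = to_fract (G $ n) \<longleftrightarrow>
          to_fract (B n) = to_fract (fact n * G $ n)"
        by (simp add: to_fract_fact field_simps)
      then show ?thesis by (simp only: to_fract_eq_iff)
    qed
    then show ?thesis unfolding G fract_fps_def by (auto simp: fps_eq_iff fun_eq_iff)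
  qed
  show ?thesis unfolding eq by blast
qed

end

theory Submission
  imports Defs
begin

text \<open>Write \<open>a = 1 + Z\<close> and \<open>b = Y\<^sub>0 + Y\<^sub>1 Z\<close>. Splitting off the fixed points of a signed permutation
  of a finite set \<open>S\<close>, or the prefix \<open>w\<^sup>- w\<^sup>+\<close> of its pixed factorization, writes the corresponding
  polynomial as \<open>\<Sum>\<^bsub>T \<subseteq> S\<^esub> b\<^bsup>card T\<^esup> E (S - T)\<close>, where \<open>E\<close> counts signed derangements, respectively
  signed desarrangements, by \<open>Z\<^bsup>neg\<^esup>\<close>. For \<open>Y\<^sub>0 = Y\<^sub>1 = 1\<close> the sum is \<open>(card S)! a\<^bsup>card S\<^esup>\<close> in both cases,
  and these values determine \<open>E\<close> by induction on \<open>S\<close>; in particular \<open>E S\<close> depends only on \<open>card S\<close>,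
  with exponential generating function \<open>(1 - a u)\<^sup>-\<^sup>1 exp (- a u)\<close>.\<close>

section \<open>Subset convolutions and exponential generating functions\<close>

lemma sum_Pow_card:
  fixes f :: "nat \<Rightarrow> 'a::comm_semiring_1"
  assumes "finite S"
  shows "(\<Sum>T\<in>Pow S. f (card T)) = (\<Sum>k\<le>card S. of_nat (card S choose k) * f k)"
proof -
  have "(\<Sum>T\<in>Pow S. f (card T)) = (\<Sum>k\<le>card S. \<Sum>T | T \<in> Pow S \<and> card T = k. f (card T))"
    using assms by (intro sum.group[symmetric]) (auto intro: card_mono)
  also have "\<dots> = (\<Sum>k\<le>card S. of_nat (card S choose k) * f k)"
    using n_subsets[OF assms] by (intro sum.cong) auto
  finally show ?thesis .
qed

text \<open>Grouping subsets by size gives a binomial convolution, which is how exponential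
  generating functions multiply: \<open>G\<close> is read as the one of the numbers
  \<open>fact m * G $ m\<close>.\<close>

lemma fps_exp_mult_nth_Pow:
  fixes c :: "'a::field_char_0"
  assumes "finite S"
  shows "(\<Sum>T\<in>Pow S. c ^ card T * (fact (card (S - T)) * G $ card (S - T))) =
    fact (card S) * (fps_exp c * G) $ card S"
proof -
  let ?n = "card S"
  have "(\<Sum>T\<in>Pow S. c ^ card T * (fact (card (S - T)) * G $ card (S - T))) =
      (\<Sum>T\<in>Pow S. c ^ card T * (fact (?n - card T) * G $ (?n - card T)))"
    using assms by (intro sum.cong) (auto simp: card_Diff_subset finite_subset)
  also have "\<dots> = (\<Sum>k\<le>?n. of_nat (?n choose k) * (c ^ k * (fact (?n - k) * G $ (?n - k))))"
    using sum_Pow_card[OF assms, of "\<lambda>k. c ^ k * (fact (?n - k) * G $ (?n - k))"] .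
  also have "\<dots> = (\<Sum>k\<le>?n. fact ?n * (c ^ k / fact k * G $ (?n - k)))"
    by (intro sum.cong) (auto simp: binomial_fact field_simps)
  also have "\<dots> = fact ?n * (fps_exp c * G) $ ?n"
    by (simp add: fps_mult_nth atLeast0AtMost sum_distrib_left)
  finally show ?thesis .
qed

lemma fps_geometric:
  "inverse (1 - fps_X * fps_const c) = Abs_fps (\<lambda>n. c ^ n)" for c :: "'a::field"
proof (rule fps_inverse_unique, rule fps_ext)
  fix n
  show "((1 - fps_X * fps_const c) * Abs_fps (\<lambda>n. c ^ n)) $ n = 1 $ n"
    by (cases n) (simp_all add: algebra_simps)
qed

text \<open>The term \<open>T = {}\<close> contributes \<open>D S\<close> and \<open>E S\<close>
  respectively; every other term involves a proper subset of \<open>S\<close>, where the two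
  functions agree by induction. The bound \<open>U\<close> makes it possible to assume the identity
  for sets of positive integers only.\<close>

lemma Pow_convolution_cancel:
  fixes D E :: "'a set \<Rightarrow> 'b::comm_ring_1"
  assumes "finite S" "S \<subseteq> U"
    and "\<And>S. finite S \<Longrightarrow> S \<subseteq> U \<Longrightarrow>
      (\<Sum>T\<in>Pow S. a ^ card T * D (S - T)) = (\<Sum>T\<in>Pow S. a ^ card T * E (S - T))"
  shows "D S = E S"
  using assms(1,2)
proof (induction S rule: finite_psubset_induct)
  case (psubset S)
  have "(\<Sum>T\<in>Pow S. a ^ card T * F (S - T)) = F S + (\<Sum>T\<in>Pow S - {{}}. a ^ card T * F (S - T))"
    for F :: "'a set \<Rightarrow> 'b"
    using psubset.hyps sum.remove[of "Pow S" "{}" "\<lambda>T. a ^ card T * F (S - T)"] by simp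
  moreover have "(\<Sum>T\<in>Pow S - {{}}. a ^ card T * D (S - T)) =
      (\<Sum>T\<in>Pow S - {{}}. a ^ card T * E (S - T))"
  proof (rule sum.cong[OF refl])
    fix T assume "T \<in> Pow S - {{}}"
    then have "S - T \<subset> S" by auto
    then show "a ^ card T * D (S - T) = a ^ card T * E (S - T)"
      using psubset by auto
  qed
  ultimately show ?case using assms(3)[of S] psubset by simp
qed

text \<open>The convolution with weight \<open>a\<close> is known and determines \<open>E\<close>;
  convolving the resulting values with weight \<open>b\<close> then gives the generating function of
  the theorem.\<close>

lemma Pow_convolution_gen_fun:
  fixes E :: "'a set \<Rightarrow> 'b::field_char_0"
  assumes "finite S" "S \<subseteq> U"
    and E: "\<And>S. finite S \<Longrightarrow> S \<subseteq> U \<Longrightarrow>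
      (\<Sum>T\<in>Pow S. a ^ card T * E (S - T)) = fact (card S) * a ^ card S"
  shows "(\<Sum>T\<in>Pow S. b ^ card T * E (S - T)) =
    fact (card S) * (inverse (1 - fps_X * fps_const a) * (fps_exp b / fps_exp a)) $ card S"
proof -
  \<comment> \<open>The only candidate for the exponential generating function of \<open>E\<close>:
    multiplied by \<open>fps_exp a\<close> it becomes the geometric series of \<open>a\<close>,
    whose coefficients times factorials are the assumed values.\<close>
  define G where "G = inverse (1 - fps_X * fps_const a) / fps_exp a"
  have exp_G: "fps_exp c * G = inverse (1 - fps_X * fps_const a) * (fps_exp c / fps_exp a)" for c
    by (simp add: G_def fps_divide_unit)
  have "E R = fact (card R) * G $ card R" if R: "finite R" "R \<subseteq> U" for R
  proof (rule Pow_convolution_cancel[OF R])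
    fix S assume S: "finite S" "S \<subseteq> U"
    have "fps_exp a * G = Abs_fps (\<lambda>n. a ^ n)"
      unfolding exp_G by (simp add: fps_geometric)
    then show "(\<Sum>T\<in>Pow S. a ^ card T * E (S - T)) =
        (\<Sum>T\<in>Pow S. a ^ card T * (fact (card (S - T)) * G $ card (S - T)))"
      using E[OF S] fps_exp_mult_nth_Pow[OF S(1), of a G] by simp
  qed
  then have "(\<Sum>T\<in>Pow S. b ^ card T * E (S - T)) =
      (\<Sum>T\<in>Pow S. b ^ card T * (fact (card (S - T)) * G $ card (S - T)))"
    using assms(1,2) by (intro sum.cong) auto
  then show ?thesis using fps_exp_mult_nth_Pow[OF assms(1), of b G] by (simp only: exp_G)
qed

section \<open>Signed words as unsigned permutations with a set of negated letters\<close>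

text \<open>Cutting off the prefix of a pixed factorization leaves a word whose absolute values need
  not form an interval, so the set of absolute values is a parameter.\<close>

definition signed_words :: "int set \<Rightarrow> int list set" where
  "signed_words S = {w. map abs w \<in> permutations_of_set S}"

lemma signed_words_iff:
  "w \<in> signed_words S \<longleftrightarrow> distinct (map abs w) \<and> abs ` set w = S"
  by (auto simp: signed_words_def permutations_of_set_def)

lemma signed_perms_eq: "signed_perms n = signed_words {1..int n}"
proof -
  have "set w \<subseteq> {- int n..-1} \<union> {1..int n}" if "map abs w \<in> permutations_of_set {1..int n}" for w
  proof
    fix x assume "x \<in> set w"
    then have "\<bar>x\<bar> \<in> {1..int n}" using permutations_of_setD(1)[OF that] by force
    then show "x \<in> {- int n..-1} \<union> {1..int n}" by auto
  qed
  then show ?thesis unfolding signed_perms_def signed_words_def by blast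
qed

definition negate_in :: "int set \<Rightarrow> int \<Rightarrow> int" where
  "negate_in N x = (if x \<in> N then - x else x)"

lemma abs_negate_in: "x > 0 \<Longrightarrow> \<bar>negate_in N x\<bar> = x"
  by (simp add: negate_in_def)

text \<open>As the absolute values are distinct and nonzero, \<open>x\<close> and \<open>- x\<close>
  never both occur. Hence the set of negated absolute values determines the sign of every
  letter.\<close>

lemma negate_in_abs:
  assumes "distinct (map abs w)" "0 \<notin> set w" "x \<in> set w"
  shows "negate_in {y \<in> abs ` set w. - y \<in> set w} \<bar>x\<bar> = x"
proof -
  have "x \<noteq> 0" using assms by auto
  then have "- x \<notin> set w"
    using assms by (auto simp: distinct_map dest: inj_onD[of abs _ "-x" x])
  then show ?thesis
    using assms(3) \<open>x \<noteq> 0\<close> by (auto simp: negate_in_def abs_if split: if_splits)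
qed

text \<open>A negative letter can only arise from an element of \<open>N\<close>, since the elements
  of \<open>T\<close> are positive. So \<open>N\<close> can be read off from the signed
  letters.\<close>

lemma negated_letters_negate_in:
  assumes "T \<subseteq> {0<..}" "N \<subseteq> T"
  shows "{x \<in> T. - x \<in> negate_in N ` T} = N"
proof -
  have "- x \<in> negate_in N ` T \<longleftrightarrow> x \<in> N" if x: "x \<in> T" for x
  proof
    assume "- x \<in> negate_in N ` T"
    then obtain y where y: "y \<in> T" "- x = negate_in N y" by blast
    then have "x > 0" "y > 0" using x assms by auto
    then show "x \<in> N" using y(2) by (auto simp: negate_in_def split: if_splits)
  qed (use x in \<open>auto simp: negate_in_def\<close>)
  then show ?thesis using assms(2) by auto
qed

text \<open>A signed word corresponds bijectively to the pair of its word of absolute values and the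
  set of those values that carry a minus sign.\<close>

lemma sum_signed_words:
  assumes "S \<subseteq> {0<..}"
  shows "(\<Sum>w\<in>signed_words S. g w) =
    (\<Sum>v\<in>permutations_of_set S. \<Sum>N\<in>Pow S. g (map (negate_in N) v))"
proof -
  let ?neg = "\<lambda>w. {x \<in> abs ` set w. - x \<in> set w}"
  have inv: "map abs (map (negate_in N) v) = v" if "v \<in> permutations_of_set S" for v N
  proof -
    have "\<bar>negate_in N x\<bar> = x" if "x \<in> set v" for x
      using that permutations_of_setD(1)[OF \<open>v \<in> permutations_of_set S\<close>] assms
      by (intro abs_negate_in) auto
    then show ?thesis by (simp add: map_idI)
  qed
  have "(\<Sum>w\<in>signed_words S. g w) =
      (\<Sum>(v, N)\<in>permutations_of_set S \<times> Pow S. g (map (negate_in N) v))"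
  proof (rule sum.reindex_bij_witness[of _ "\<lambda>(v, N). map (negate_in N) v"
        "\<lambda>w. (map abs w, ?neg w)"])
    fix w assume w: "w \<in> signed_words S"
    then have set: "abs ` set w = S" and dist: "distinct (map abs w)"
      by (simp_all add: signed_words_iff)
    have "0 \<notin> set w" using set assms by force
    then have inv': "map (negate_in (?neg w)) (map abs w) = w"
      using negate_in_abs[OF dist] by (simp add: map_idI)
    then show "(case (map abs w, ?neg w) of (v, N) \<Rightarrow> map (negate_in N) v) = w"
      by simp
    show "(map abs w, ?neg w) \<in> permutations_of_set S \<times> Pow S"
      using w set by (auto simp: signed_words_def)
    show "(case (map abs w, ?neg w) of (v, N) \<Rightarrow> g (map (negate_in N) v)) = g w"
      using inv' by simp
  next
    fix p assume "p \<in> permutations_of_set S \<times> Pow S"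
    then obtain v N where p: "p = (v, N)" and v: "v \<in> permutations_of_set S" and N: "N \<subseteq> S"
      by auto
    define u where "u = map (negate_in N) v"
    have abs_u: "map abs u = v" unfolding u_def by (rule inv[OF v])
    then have "abs ` set u = S" using permutations_of_setD(1)[OF v] by (metis set_map)
    moreover have "set u = negate_in N ` S" using permutations_of_setD(1)[OF v] by (simp add: u_def)
    ultimately have "?neg u = N" using negated_letters_negate_in[OF assms N] by simp
    then show "(map abs (case p of (v, N) \<Rightarrow> map (negate_in N) v),
        ?neg (case p of (v, N) \<Rightarrow> map (negate_in N) v)) = p"
      using abs_u unfolding p prod.case u_def[symmetric] by simp
    show "(case p of (v, N) \<Rightarrow> map (negate_in N) v) \<in> signed_words S"
      using abs_u v unfolding p prod.case u_def[symmetric] by (simp add: signed_words_def)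
  qed
  then show ?thesis by (simp add: sum.cartesian_product)
qed

lemma neg_map_negate_in:
  assumes "S \<subseteq> {0<..}" "v \<in> permutations_of_set S" "N \<subseteq> S"
  shows "neg (map (negate_in N) v) = card N"
proof -
  have set: "set v = S" and dist: "distinct v" using permutations_of_setD[OF assms(2)] by auto
  have "filter (\<lambda>x. negate_in N x < 0) v = filter (\<lambda>x. x \<in> N) v"
    using assms(1) set by (intro filter_cong) (auto simp: negate_in_def)
  moreover have "card N = length (filter (\<lambda>x. x \<in> N) v)"
    using distinct_card[of "filter (\<lambda>x. x \<in> N) v"] dist set assms(3)
    by (simp add: Collect_conj_eq Int_absorb1)
  ultimately show ?thesis by (simp add: neg_def filter_map comp_def)
qed

text \<open>The binomial theorem, as the expansion of a product of \<open>card S\<close> equal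
  factors \<open>x + y\<close>.\<close>

lemma sum_Pow_power_card:
  fixes x y :: "'a::comm_ring_1"
  assumes "finite S"
  shows "(\<Sum>N\<in>Pow S. x ^ card N * y ^ card (S - N)) = (x + y) ^ card S"
  using prod_add[OF assms, of "\<lambda>_. x" "\<lambda>_. y"] by simp

text \<open>The absolute values can be ordered in \<open>fact (card S)\<close> ways, and each of
  them independently contributes \<open>1\<close> when positive and \<open>z\<close> when
  negative.\<close>

lemma sum_signed_words_neg:
  fixes z :: "'a::field_char_0"
  assumes "finite S" "S \<subseteq> {0<..}"
  shows "(\<Sum>w\<in>signed_words S. z ^ neg w) = fact (card S) * (1 + z) ^ card S"
proof -
  have "(\<Sum>w\<in>signed_words S. z ^ neg w) =
      (\<Sum>v\<in>permutations_of_set S. \<Sum>N\<in>Pow S. z ^ card N)"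
    unfolding sum_signed_words[OF assms(2)]
    using assms neg_map_negate_in by (intro sum.cong) auto
  then show ?thesis
    using sum_Pow_power_card[OF assms(1), of z 1] assms(1) by (simp add: add.commute)
qed

section \<open>Fixed points of signed permutations\<close>

text \<open>Mediates between positions, which are naturals, and the letters on which permutations
  act, which are integers.\<close>

lemma card_nat_interval:
  "card {i \<in> {1..n}. P (int i)} = card {x \<in> {1..int n}. P x}"
proof (rule bij_betw_same_card[of int])
  have "x \<in> int ` {i \<in> {1..n}. P (int i)}" if "1 \<le> x" "x \<le> int n" "P x" for x
    using that by (intro image_eqI[of _ _ "nat x"]) auto
  then show "bij_betw int {i \<in> {1..n}. P (int i)} {x \<in> {1..int n}. P x}"
    by (auto simp: bij_betw_def)
qed

text \<open>Every signed fixed point comes from a fixed point of \<open>p\<close>; membership in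
  \<open>N\<close> decides whether it is a negative or a positive one.\<close>

lemma fix_map_negate_in:
  assumes p: "p permutes {1..int n}"
  defines "w N \<equiv> map (negate_in N) (map p [1..int n])"
  shows "fix_minus (w N) = card ({x \<in> {1..int n}. p x = x} \<inter> N)"
    and "fix_plus (w N) = card ({x \<in> {1..int n}. p x = x} - N)"
proof -
  have len: "length (w N) = n" by (simp add: w_def)
  have nth: "w N ! (i - 1) = negate_in N (p (int i))" if "i \<in> {1..n}" for i
  proof -
    have "i - 1 < length [1..int n]" "[1..int n] ! (i - 1) = int i"
      using that by (auto simp: nth_upto of_nat_diff)
    then show ?thesis by (simp add: w_def del: length_upto)
  qed
  \<comment> \<open>Positivity excludes \<open>p x = - x\<close>, so a signed letter can match its
    position up to sign only if \<open>p x = x\<close>.\<close>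
  have pos: "p x > 0" if "x \<in> {1..int n}" for x
    using that permutes_in_image[OF p, of x] by auto
  have minus: "negate_in N (p x) = - x \<longleftrightarrow> p x = x \<and> x \<in> N"
    and plus: "negate_in N (p x) = x \<longleftrightarrow> p x = x \<and> x \<notin> N" if "x \<in> {1..int n}" for x
    using that pos[OF that] by (auto simp: negate_in_def)
  have "fix_minus (w N) = card {i \<in> {1..n}. negate_in N (p (int i)) = - int i}"
    unfolding fix_minus_def len using nth by (intro arg_cong[of _ _ card]) auto
  also have "\<dots> = card {x \<in> {1..int n}. negate_in N (p x) = - x}"
    by (rule card_nat_interval)
  also have "{x \<in> {1..int n}. negate_in N (p x) = - x} = {x \<in> {1..int n}. p x = x} \<inter> N"
    using minus by blast
  finally show "fix_minus (w N) = card ({x \<in> {1..int n}. p x = x} \<inter> N)" .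
  have "fix_plus (w N) = card {i \<in> {1..n}. negate_in N (p (int i)) = int i}"
    unfolding fix_plus_def len using nth by (intro arg_cong[of _ _ card]) auto
  also have "\<dots> = card {x \<in> {1..int n}. negate_in N (p x) = x}"
    by (rule card_nat_interval)
  also have "{x \<in> {1..int n}. negate_in N (p x) = x} = {x \<in> {1..int n}. p x = x} - N"
    using plus by blast
  finally show "fix_plus (w N) = card ({x \<in> {1..int n}. p x = x} - N)" .
qed

text \<open>Here \<open>F\<close> stands for the fixed points of a permutation and \<open>N\<close>
  for its negated letters. The signs are chosen independently, so the sum is a product with one
  factor for each element of \<open>S\<close>.\<close>

lemma sum_Pow_marked:
  fixes y0 y1 z :: "'a::comm_ring_1"
  assumes "finite S" "F \<subseteq> S"
  shows "(\<Sum>N\<in>Pow S. y1 ^ card (F \<inter> N) * y0 ^ card (F - N) * z ^ card N) =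
    (y0 + y1 * z) ^ card F * (1 + z) ^ card (S - F)"
proof -
  let ?m = "\<lambda>y x. if x \<in> F then y else 1"
  have marked: "(\<Prod>x\<in>R. ?m y x) = y ^ card (F \<inter> R)" if "R \<subseteq> S" for R and y :: 'a
    using finite_subset[OF that assms(1)] by (simp add: prod.If_cases Int_commute)
  have "(\<Sum>N\<in>Pow S. y1 ^ card (F \<inter> N) * y0 ^ card (F - N) * z ^ card N) =
      (\<Sum>N\<in>Pow S. (\<Prod>x\<in>N. ?m y1 x * z) * (\<Prod>x\<in>S - N. ?m y0 x))"
  proof (rule sum.cong[OF refl])
    fix N assume "N \<in> Pow S"
    moreover have "F - N = F \<inter> (S - N)" using assms(2) by blast
    ultimately show "y1 ^ card (F \<inter> N) * y0 ^ card (F - N) * z ^ card N =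
        (\<Prod>x\<in>N. ?m y1 x * z) * (\<Prod>x\<in>S - N. ?m y0 x)"
      using marked[of N y1] marked[of "S - N" y0] by (simp add: prod.distrib)
  qed
  \<comment> \<open>Expanding the product, the first summand puts \<open>x\<close> into
    \<open>N\<close> and the second leaves it out.\<close>
  also have "\<dots> = (\<Prod>x\<in>S. ?m y1 x * z + ?m y0 x)"
    by (rule prod_add[OF assms(1), symmetric])
  also have "\<dots> = (\<Prod>x\<in>S. if x \<in> F then y0 + y1 * z else 1 + z)"
    by (intro prod.cong) (auto simp: add.commute)
  also have "\<dots> = (y0 + y1 * z) ^ card F * (1 + z) ^ card (S - F)"
    using assms by (simp add: prod.If_cases Int_absorb1 Diff_eq)
  finally show ?thesis .
qed

lemma bij_betw_permutes_permutations_of_set: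
  "bij_betw (\<lambda>p. map p [1..int n]) {p. p permutes {1..int n}} (permutations_of_set {1..int n})"
proof -
  let ?S = "{1..int n}" and ?f = "\<lambda>p. map p [1..int n]"
  have inj: "inj_on ?f {p. p permutes ?S}"
  proof (intro inj_onI ext)
    fix p q x assume pq: "p \<in> {p. p permutes ?S}" "q \<in> {p. p permutes ?S}" "?f p = ?f q"
    show "p x = q x"
      using pq permutes_not_in[of p ?S x] permutes_not_in[of q ?S x] by (cases "x \<in> ?S") auto
  qed
  have "?f ` {p. p permutes ?S} \<subseteq> permutations_of_set ?S"
    by (auto simp: permutations_of_set_def permutes_image distinct_map permutes_inj_on)
  \<comment> \<open>Surjectivity by counting: both finite sets have \<open>fact n\<close> elements,
    so the inclusion is an equality.\<close>
  moreover have "card (?f ` {p. p permutes ?S}) = card (permutations_of_set ?S)"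
    using card_image[OF inj] by (simp add: card_permutations)
  ultimately show ?thesis
    using inj by (simp add: bij_betw_def card_subset_eq)
qed

text \<open>Removing the fixed points leaves a derangement of the remaining elements;
  \<open>permutes (S - T)\<close> already encodes the identity on \<open>T\<close>.\<close>

lemma permutes_with_fixpoints:
  assumes "T \<subseteq> S"
  shows "{p. p permutes S \<and> {x \<in> S. p x = x} = T} =
    {p. p permutes (S - T) \<and> (\<forall>x\<in>S - T. p x \<noteq> x)}"
proof (intro equalityI subsetI; clarify)
  fix p assume p: "p permutes S" and T: "T = {x \<in> S. p x = x}"
  have "p permutes (S - T)" using p by (rule permutes_superset) (auto simp: T)
  then show "p permutes (S - {x \<in> S. p x = x}) \<and> (\<forall>x\<in>S - {x \<in> S. p x = x}. p x \<noteq> x)"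
    unfolding T by auto
next
  fix p assume p: "p permutes (S - T)" "\<forall>x\<in>S - T. p x \<noteq> x"
  then have "p permutes S" by (auto intro: permutes_subset)
  moreover have "p x = x" if "x \<in> T" for x using permutes_not_in[OF p(1)] that by blast
  ultimately show "p permutes S \<and> {x \<in> S. p x = x} = T" using p(2) assms by auto
qed

text \<open>Permutations are grouped by their fixed point set \<open>T\<close>. With
  \<open>a = 1 + z\<close>, the power of \<open>a\<close> in the inner sum accounts for all choices
  of signs on a derangement.\<close>

lemma sum_permutes_by_fixpoints:
  fixes a b :: "'a::comm_ring_1"
  assumes "finite S"
  shows "(\<Sum>p | p permutes S. b ^ card {x \<in> S. p x = x} * a ^ card (S - {x \<in> S. p x = x})) =
    (\<Sum>T\<in>Pow S. b ^ card T *
      (\<Sum>p | p permutes (S - T) \<and> (\<forall>x\<in>S - T. p x \<noteq> x). a ^ card (S - T)))"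
proof -
  let ?F = "\<lambda>p. {x \<in> S. p x = x}"
  let ?h = "\<lambda>p. b ^ card (?F p) * a ^ card (S - ?F p)"
  have "(\<Sum>p | p permutes S. ?h p) =
      (\<Sum>T\<in>Pow S. \<Sum>p | p \<in> {p. p permutes S} \<and> ?F p = T. ?h p)"
    using assms by (intro sum.group[symmetric]) (auto intro: finite_permutations)
  also have "\<dots> = (\<Sum>T\<in>Pow S. b ^ card T *
      (\<Sum>p | p permutes (S - T) \<and> (\<forall>x\<in>S - T. p x \<noteq> x). a ^ card (S - T)))"
  proof (rule sum.cong[OF refl])
    fix T assume "T \<in> Pow S"
    then have eq: "{p. p permutes S \<and> ?F p = T} =
        {p. p permutes (S - T) \<and> (\<forall>x\<in>S - T. p x \<noteq> x)}"
      using permutes_with_fixpoints[of T S] by blast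
    have "(\<Sum>p | p permutes S \<and> ?F p = T. ?h p) =
        (\<Sum>p | p permutes S \<and> ?F p = T. b ^ card T * a ^ card (S - T))"
      by (intro sum.cong) auto
    then show "(\<Sum>p | p \<in> {p. p permutes S} \<and> ?F p = T. ?h p) = b ^ card T *
        (\<Sum>p | p permutes (S - T) \<and> (\<forall>x\<in>S - T. p x \<noteq> x). a ^ card (S - T))"
      unfolding mem_Collect_eq eq by (simp add: sum_distrib_left)
  qed
  finally show ?thesis .
qed

lemma sum_fix_gen_fun:
  fixes y0 y1 z :: "'a::field_char_0"
  shows "(\<Sum>w\<in>signed_perms n. y1 ^ fix_minus w * y0 ^ fix_plus w * z ^ neg w) =
    fact n * (inverse (1 - fps_X * fps_const (1 + z)) *
      (fps_exp (y0 + y1 * z) / fps_exp (1 + z))) $ n"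
proof -
  let ?S = "{1..int n}"
  let ?F = "\<lambda>p. {x \<in> ?S. p x = x}"
  let ?g = "\<lambda>w. y1 ^ fix_minus w * y0 ^ fix_plus w * z ^ neg w"
  \<comment> \<open>The polynomial of signed derangements of \<open>R\<close>, with the signs
    already summed out.\<close>
  let ?E = "\<lambda>R :: int set. \<Sum>p | p permutes R \<and> (\<forall>x\<in>R. p x \<noteq> x). (1 + z) ^ card R"
  have S: "?S \<subseteq> {0<..}" by auto
  have "(\<Sum>w\<in>signed_perms n. ?g w) =
      (\<Sum>p | p permutes ?S. \<Sum>N\<in>Pow ?S. ?g (map (negate_in N) (map p [1..int n])))"
    unfolding signed_perms_eq sum_signed_words[OF S]
    by (rule sum.reindex_bij_betw[OF bij_betw_permutes_permutations_of_set, symmetric])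
  also have "\<dots> = (\<Sum>p | p permutes ?S. \<Sum>N\<in>Pow ?S.
      y1 ^ card (?F p \<inter> N) * y0 ^ card (?F p - N) * z ^ card N)"
  proof (intro sum.cong refl)
    fix p N assume "p \<in> {p. p permutes ?S}" "N \<in> Pow ?S"
    then have p: "p permutes ?S" and N: "N \<subseteq> ?S" by auto
    have "map p [1..int n] \<in> permutations_of_set ?S"
      using p bij_betwE[OF bij_betw_permutes_permutations_of_set] by blast
    then have "neg (map (negate_in N) (map p [1..int n])) = card N"
      using neg_map_negate_in[OF S _ N] by blast
    then show "?g (map (negate_in N) (map p [1..int n])) =
        y1 ^ card (?F p \<inter> N) * y0 ^ card (?F p - N) * z ^ card N"
      by (simp only: fix_map_negate_in[OF p])
  qed
  also have "\<dots> = (\<Sum>p | p permutes ?S. (y0 + y1 * z) ^ card (?F p) * (1 + z) ^ card (?S - ?F p))"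
    by (intro sum.cong refl sum_Pow_marked) auto
  also have "\<dots> = (\<Sum>T\<in>Pow ?S. (y0 + y1 * z) ^ card T * ?E (?S - T))"
    by (rule sum_permutes_by_fixpoints) simp
  also have "\<dots> = fact (card ?S) * (inverse (1 - fps_X * fps_const (1 + z)) *
      (fps_exp (y0 + y1 * z) / fps_exp (1 + z))) $ card ?S"
  proof (rule Pow_convolution_gen_fun)
    \<comment> \<open>For equal weights on fixed and other points, every permutation of
      \<open>S\<close> contributes the same power of \<open>1 + z\<close>, and there are
      \<open>fact (card S)\<close> of them.\<close>
    fix S :: "int set" assume S: "finite S"
    have "(1 + z) ^ card {x \<in> S. p x = x} * (1 + z) ^ card (S - {x \<in> S. p x = x}) =
        (1 + z) ^ card S" for p
    proof -
      have "card {x \<in> S. p x = x} + card (S - {x \<in> S. p x = x}) = card S"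
        using S card_mono[of S "{x \<in> S. p x = x}"] by (simp add: card_Diff_subset)
      then show ?thesis by (simp only: power_add[symmetric])
    qed
    then show "(\<Sum>T\<in>Pow S. (1 + z) ^ card T * ?E (S - T)) = fact (card S) * (1 + z) ^ card S"
      unfolding sum_permutes_by_fixpoints[OF S, symmetric]
      using S by (simp add: card_permutations)
  qed auto
  finally show ?thesis by simp
qed

section \<open>Uniqueness of the pixed factorization\<close>

text \<open>A nonempty desarrangement starts with a maximal descending run of even length. If
  \<open>p\<close> has two letters, the word starts with an ascent instead; if \<open>p\<close> is a
  single letter, prepending it changes the parity of the run.\<close>

lemma not_desarrangement_append:
  assumes "sorted_wrt (<) p" "p \<noteq> []" "desarrangement d"
  shows "\<not> desarrangement (p @ d)"
proof
  assume "desarrangement (p @ d)"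
  then obtain k where k: "k \<ge> 1" "2 * k \<le> length (p @ d)"
    "\<forall>i\<in>{1..<2 * k}. (p @ d) ! (i - 1) > (p @ d) ! i"
    "2 * k < length (p @ d) \<longrightarrow> (p @ d) ! (2 * k - 1) < (p @ d) ! (2 * k)"
    using assms(2) unfolding desarrangement_def by blast
  have step: "(p @ d) ! i > (p @ d) ! Suc i" if "Suc i < 2 * k" for i
    using k(3) that by force
  obtain x q where p: "p = x # q" using assms(2) by (cases p) auto
  show False
  proof (cases q)
    case (Cons y r)
    then show False using step[of 0] k(1) assms(1) p by simp
  next
    case Nil
    have "d \<noteq> []" using k(1,2) p Nil by auto
    then obtain l where l: "l \<ge> 1" "2 * l \<le> length d" "\<forall>i\<in>{1..<2 * l}. d ! (i - 1) > d ! i"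
      "2 * l < length d \<longrightarrow> d ! (2 * l - 1) < d ! (2 * l)"
      using assms(3) unfolding desarrangement_def by blast
    show False
    \<comment> \<open>The letters of \<open>d\<close> sit one place later in \<open>p @ d\<close>,
      so the runs of lengths \<open>2 * l\<close> and \<open>2 * k\<close> cannot end at the same
      letter. Whichever ends first along \<open>d\<close> ends in an ascent where the other still
      descends.\<close>
    proof (cases "l < k")
      case True
      then have "2 * l < length d" using k(2) p Nil by simp
      moreover have "d ! (2 * l) < d ! (2 * l - 1)"
        using step[of "2 * l"] True l(1) p Nil by (simp add: nth_Cons')
      ultimately show False using l(4) by simp
    next
      case False
      then have "2 * k - 1 \<in> {1..<2 * l}" using k(1) by auto
      then have "d ! (2 * k - 2) > d ! (2 * k - 1)"
        using l(3) by (metis diff_diff_left one_add_one)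
      moreover have "2 * k < length (p @ d)" using False l(2) p Nil by simp
      then have "d ! (2 * k - 2) < d ! (2 * k - 1)"
        using k(1,4) p Nil by (simp add: nth_Cons' numeral_2_eq_2)
      ultimately show False by simp
    qed
  qed
qed

text \<open>A longer suffix has the form \<open>r @ d\<close> with \<open>r\<close> a nonempty
  suffix of \<open>p\<close>, hence increasing, and is therefore no desarrangement. This is the
  converse of \<open>prefix_increasing\<close>.\<close>

lemma longest_desarrangement_suffixI:
  assumes "sorted_wrt (<) p" "desarrangement d"
  shows "longest_desarrangement_suffix (p @ d) d"
  unfolding longest_desarrangement_suffix_def
proof (intro conjI allI impI)
  fix d' assume d': "suffix d' (p @ d) \<and> desarrangement d'"
  then consider "suffix d' d" | r where "d' = r @ d" "suffix r p"
    by (auto simp: suffix_append)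
  then show "length d' \<le> length d"
  proof cases
    case 1
    then show ?thesis by (rule suffix_length_le)
  next
    case 2
    then have "sorted_wrt (<) r" using assms(1) by (auto simp: suffix_def sorted_wrt_append)
    then have "r = []" using not_desarrangement_append[of r d] assms(2) d' 2 by auto
    then show ?thesis using 2 by simp
  qed
qed (use assms in \<open>auto simp: suffix_def\<close>)

lemma longest_desarrangement_suffix_unique:
  assumes "longest_desarrangement_suffix w d" "longest_desarrangement_suffix w d'"
  shows "d = d'"
proof -
  have "length d = length d'"
    using assms unfolding longest_desarrangement_suffix_def by (intro le_antisym) blast+
  moreover obtain p p' where "w = p @ d" "w = p' @ d'"
    using assms unfolding longest_desarrangement_suffix_def suffix_def by blast
  ultimately show ?thesis by (metis append_eq_append_conv)
qed

lemma sorted_append_filter_sign: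
  fixes p :: "int list"
  assumes "sorted_wrt (<) p" "0 \<notin> set p"
  shows "filter (\<lambda>x. x < 0) p @ filter (\<lambda>x. x > 0) p = p"
  using assms
proof (induction p)
  case (Cons x p)
  then show ?case
  proof (cases "x < 0")
    case False
    then have "x > 0" using Cons.prems by auto
    then have "\<forall>y\<in>set p. y > 0" using Cons.prems by auto
    then have "filter (\<lambda>x. x < 0) p = []" by (auto simp: filter_empty_conv)
    then show ?thesis using Cons \<open>x > 0\<close> by simp
  qed auto
qed simp

text \<open>Makes the definite description computable: \<open>d\<close> is forced as the longest
  desarrangement suffix, and the signs of the letters then split \<open>p\<close>.\<close>

lemma pixed_factorization_eq:
  assumes "sorted_wrt (<) p" "0 \<notin> set p" "desarrangement d"
  shows "pixed_factorization (p @ d) = (filter (\<lambda>x. x < 0) p, filter (\<lambda>x. x > 0) p, d)"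
  unfolding pixed_factorization_def
proof (rule the_equality)
  show "is_pixed_factorization (p @ d) (filter (\<lambda>x. x < 0) p, filter (\<lambda>x. x > 0) p, d)"
    using assms longest_desarrangement_suffixI[OF assms(1,3)] sorted_append_filter_sign[OF assms(1,2)]
    by (auto simp: is_pixed_factorization_def sorted_wrt_filter simp flip: append_assoc)
next
  fix f assume f: "is_pixed_factorization (p @ d) f"
  obtain m q e where e: "f = (m, q, e)" by (metis prod_cases3)
  have "e = d"
    using f longest_desarrangement_suffix_unique longest_desarrangement_suffixI[OF assms(1,3)]
    unfolding e is_pixed_factorization_def by blast
  then have p: "p = m @ q" using f unfolding e is_pixed_factorization_def by auto
  have sign: "\<forall>x\<in>set m. x < 0" "\<forall>x\<in>set q. x > 0"
    using f unfolding e is_pixed_factorization_def by auto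
  then have "filter (\<lambda>x. x < 0) m = m" "filter (\<lambda>x. x < 0) q = []"
    "filter (\<lambda>x. x > 0) m = []" "filter (\<lambda>x. x > 0) q = q"
    by (auto simp: filter_empty_conv filter_id_conv)
  then show "f = (filter (\<lambda>x. x < 0) p, filter (\<lambda>x. x > 0) p, d)"
    by (simp add: e p \<open>e = d\<close>)
qed

section \<open>Decomposition of signed words into an increasing prefix and a desarrangement\<close>

text \<open>This is the prefix \<open>w\<^sup>- w\<^sup>+\<close>: being increasing, it is
  determined by its set of letters, that is, by the absolute values \<open>T\<close> and the negated
  ones \<open>N\<close>.\<close>

definition increasing_word :: "int set \<Rightarrow> int set \<Rightarrow> int list" where
  "increasing_word T N = sorted_list_of_set (negate_in N ` T)"

lemma
  assumes "finite T" "T \<subseteq> {0<..}" "N \<subseteq> T"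
  shows sorted_increasing_word: "sorted_wrt (<) (increasing_word T N)"
    and set_increasing_word: "set (increasing_word T N) = negate_in N ` T"
    and zero_not_in_increasing_word: "0 \<notin> set (increasing_word T N)"
    and increasing_word_in_signed_words: "increasing_word T N \<in> signed_words T"
    and negative_increasing_word: "length (filter (\<lambda>x. x < 0) (increasing_word T N)) = card N"
    and positive_increasing_word: "length (filter (\<lambda>x. x > 0) (increasing_word T N)) = card (T - N)"
proof -
  let ?u = "increasing_word T N"
  show set: "set ?u = negate_in N ` T" using assms(1) by (simp add: increasing_word_def)
  have dist: "distinct ?u" by (simp add: increasing_word_def)
  show "sorted_wrt (<) ?u" by (simp add: increasing_word_def strict_sorted_list_of_set)
  show "0 \<notin> set ?u" using assms(2) unfolding set by (auto simp: negate_in_def split: if_splits)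
  have abs: "\<bar>negate_in N x\<bar> = x" if "x \<in> T" for x
    using that assms(2) by (intro abs_negate_in) auto
  have "abs ` set ?u = T" unfolding set image_image using abs by simp
  moreover have "inj_on abs (set ?u)" unfolding set by (intro inj_onI) (auto simp: abs)
  ultimately show "?u \<in> signed_words T"
    using dist by (simp add: signed_words_iff distinct_map)
  have "{x. x < 0} \<inter> negate_in N ` T = uminus ` N"
    using assms(2,3) by (force simp: negate_in_def)
  then show "length (filter (\<lambda>x. x < 0) ?u) = card N"
    using distinct_length_filter[OF dist] by (simp add: set card_image)
  have "{x. x > 0} \<inter> negate_in N ` T = T - N"
    using assms(2,3) by (force simp: negate_in_def)
  then show "length (filter (\<lambda>x. x > 0) ?u) = card (T - N)"
    using distinct_length_filter[OF dist] by (simp add: set)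
qed

lemma increasing_word_abs:
  assumes "sorted_wrt (<) p" "distinct (map abs p)" "0 \<notin> set p"
  shows "increasing_word (abs ` set p) {x \<in> abs ` set p. - x \<in> set p} = p"
proof -
  have "negate_in {x \<in> abs ` set p. - x \<in> set p} ` abs ` set p = set p"
    using negate_in_abs[OF assms(2,3)] by (simp add: image_image)
  then show ?thesis
    using assms(1) by (simp add: increasing_word_def strict_sorted_iff sorted_list_of_set.idem_if_sorted_distinct)
qed

lemma finite_signed_words: "finite S \<Longrightarrow> finite (signed_words S)"
proof (rule finite_subset)
  assume "finite S"
  then show "finite {w. set w \<subseteq> S \<union> uminus ` S \<and> length w = card S}"
    by (intro finite_lists_length_eq) simp
  show "signed_words S \<subseteq> {w. set w \<subseteq> S \<union> uminus ` S \<and> length w = card S}"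
  proof
    fix w assume w: "w \<in> signed_words S"
    then have "abs ` set w = S" "length (map abs w) = card S"
      using permutations_of_setD(1)[of "map abs w" S] length_finite_permutations_of_set[of "map abs w" S]
      by (auto simp: signed_words_def)
    moreover have "x \<in> abs ` set w \<union> uminus ` abs ` set w" if "x \<in> set w" for x
      using that by (cases "x \<ge> 0") (force simp: image_image)+
    ultimately show "w \<in> {w. set w \<subseteq> S \<union> uminus ` S \<and> length w = card S}" by auto
  qed
qed

lemma append_in_signed_words_iff:
  assumes "p \<in> signed_words T" "T \<subseteq> S"
  shows "p @ d \<in> signed_words S \<longleftrightarrow> d \<in> signed_words (S - T)"
proof -
  have p: "abs ` set p = T" "distinct (map abs p)"
    using assms(1) by (simp_all add: signed_words_iff)
  show ?thesis
    unfolding signed_words_iff map_append distinct_append set_append image_Un set_map p(1)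
    using p(2) assms(2) by blast
qed

text \<open>Appending \<open>d\<close> to \<open>increasing_word T N\<close> is a bijection from the
  triples \<open>(T, N, d)\<close> onto the signed words, because increasing prefixes and longest
  desarrangement suffixes determine each other.\<close>

lemma sum_signed_words_by_pixed_factorization:
  fixes g :: "int list \<Rightarrow> 'a::comm_monoid_add"
  assumes S: "finite S" "S \<subseteq> {0<..}"
  shows "(\<Sum>w\<in>signed_words S. g w) = (\<Sum>T\<in>Pow S. \<Sum>N\<in>Pow T.
    \<Sum>d | d \<in> signed_words (S - T) \<and> desarrangement d. g (increasing_word T N @ d))"
proof -
  let ?D = "\<lambda>T. {d. d \<in> signed_words (S - T) \<and> desarrangement d}"
  let ?A = "SIGMA T:Pow S. Pow T \<times> ?D T"
  let ?F = "\<lambda>(T, N, d). increasing_word T N @ d"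
  have fin: "finite T" and pos: "T \<subseteq> {0<..}" if "T \<subseteq> S" for T
    using that S finite_subset by auto
  have "inj_on ?F ?A"
  proof (rule inj_onI)
    fix s t assume st: "s \<in> ?A" "t \<in> ?A" "?F s = ?F t"
    obtain T N d T' N' d' where e: "s = (T, N, d)" "t = (T', N', d')" by (metis prod_cases3)
    have T: "T \<subseteq> S" "T' \<subseteq> S" and N: "N \<subseteq> T" "N' \<subseteq> T'" and d: "desarrangement d" "desarrangement d'"
      using st(1,2) unfolding e by auto
    let ?u = "increasing_word T N" and ?u' = "increasing_word T' N'"
    have eq: "?u @ d = ?u' @ d'" using st(3) unfolding e by simp
    note TN = fin[OF T(1)] pos[OF T(1)] N(1) and TN' = fin[OF T(2)] pos[OF T(2)] N(2)
    \<comment> \<open>Injectivity: both \<open>d\<close> and \<open>d'\<close> are the longest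
      desarrangement suffix of the same word, so the prefixes agree as well and yield
      \<open>T\<close> and \<open>N\<close>.\<close>
    have "longest_desarrangement_suffix (?u @ d) d" "longest_desarrangement_suffix (?u' @ d') d'"
      by (intro longest_desarrangement_suffixI sorted_increasing_word TN TN' d)+
    then have "d = d'" unfolding eq by (rule longest_desarrangement_suffix_unique)
    then have u: "?u = ?u'" using eq by simp
    have "abs ` set ?u = T" "abs ` set ?u' = T'"
      using increasing_word_in_signed_words[OF TN] increasing_word_in_signed_words[OF TN']
      by (simp_all add: signed_words_iff)
    then have TT': "T = T'" using u by simp
    have N_eq: "{x \<in> T. - x \<in> set ?u} = N" "{x \<in> T'. - x \<in> set ?u'} = N'"
      unfolding set_increasing_word[OF TN] set_increasing_word[OF TN']
      by (rule negated_letters_negate_in[OF TN(2,3)] negated_letters_negate_in[OF TN'(2,3)])+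
    have "{x \<in> T. - x \<in> set ?u} = {x \<in> T'. - x \<in> set ?u'}"
      by (rule arg_cong2[OF TT' u, of "\<lambda>R v. {x \<in> R. - x \<in> set v}"])
    then have "N = N'" unfolding N_eq .
    then show "s = t" using TT' \<open>d = d'\<close> unfolding e by simp
  qed
  moreover have "?F ` ?A = signed_words S"
  proof (intro equalityI subsetI)
    fix w assume "w \<in> ?F ` ?A"
    then obtain t where t: "t \<in> ?A" "w = ?F t" by blast
    obtain T N d where e: "t = (T, N, d)" by (metis prod_cases3)
    have w: "w = increasing_word T N @ d" and T: "T \<subseteq> S" "N \<subseteq> T"
      and d: "d \<in> signed_words (S - T)"
      using t unfolding e by simp_all
    have "increasing_word T N \<in> signed_words T"
      using fin[OF T(1)] pos[OF T(1)] T(2) by (rule increasing_word_in_signed_words)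
    then show "w \<in> signed_words S" unfolding w using append_in_signed_words_iff T(1) d by blast
  next
    fix w assume w: "w \<in> signed_words S"
    then have dist: "distinct (map abs w)" and set: "abs ` set w = S"
      by (simp_all add: signed_words_iff)
    have nz: "0 \<notin> set w" using set S(2) by force
    \<comment> \<open>Surjectivity: what precedes the longest desarrangement suffix is increasing
      and thus equal to the \<open>increasing_word\<close> of its own absolute values and negated
      letters.\<close>
    obtain d where d: "longest_desarrangement_suffix w d"
      using longest_desarrangement_suffix_ex by blast
    then obtain p where p: "w = p @ d"
      unfolding longest_desarrangement_suffix_def suffix_def by blast
    have "distinct w" using dist by (simp add: distinct_map)
    then have sorted: "sorted_wrt (<) p" using prefix_increasing d unfolding p by blast
    let ?T = "abs ` set p" and ?N = "{x \<in> abs ` set p. - x \<in> set p}"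
    have u: "increasing_word ?T ?N = p"
      using increasing_word_abs[OF sorted] dist nz p by simp
    have T: "?T \<subseteq> S" using set p by auto
    have "p \<in> signed_words ?T"
      using dist p by (simp add: signed_words_iff)
    then have "d \<in> signed_words (S - ?T)"
      using append_in_signed_words_iff[OF _ T] w p by blast
    moreover have "desarrangement d" using d unfolding longest_desarrangement_suffix_def by blast
    ultimately have "(?T, ?N, d) \<in> ?A" using T by blast
    moreover have "w = ?F (?T, ?N, d)" using u p by simp
    ultimately show "w \<in> ?F ` ?A" by blast
  qed
  ultimately have "(\<Sum>w\<in>signed_words S. g w) = (\<Sum>t\<in>?A. g (?F t))"
    using sum.reindex[of ?F ?A g] by simp
  also have "\<dots> = (\<Sum>(T, r)\<in>?A. case r of (N, d) \<Rightarrow> g (increasing_word T N @ d))"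
    by (intro sum.cong) auto
  also have "\<dots> = (\<Sum>T\<in>Pow S. \<Sum>(N, d)\<in>Pow T \<times> ?D T. g (increasing_word T N @ d))"
  proof (rule sum.Sigma[symmetric])
    have "finite (Pow T \<times> ?D T)" if "T \<subseteq> S" for T
      using fin[OF that] finite_signed_words[of "S - T"] S(1) by simp
    then show "\<forall>T\<in>Pow S. finite (Pow T \<times> ?D T)" by blast
  qed (use S(1) in simp)
  also have "\<dots> = (\<Sum>T\<in>Pow S. \<Sum>N\<in>Pow T. \<Sum>d\<in>?D T. g (increasing_word T N @ d))"
    by (simp only: sum.cartesian_product)
  finally show ?thesis .
qed

section \<open>The pixed statistics\<close>

text \<open>Each prefix letter contributes \<open>y1 * z\<close> when negative and \<open>y0\<close>
  when positive, so summing over \<open>N\<close> gives a power of \<open>y0 + y1 * z\<close>; the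
  desarrangement contributes only its negative letters.\<close>

lemma sum_pix_by_pixed_factorization:
  fixes y0 y1 z :: "'a::comm_ring_1"
  assumes S: "finite S" "S \<subseteq> {0<..}"
  shows "(\<Sum>w\<in>signed_words S. y1 ^ pix_minus w * y0 ^ pix_plus w * z ^ neg w) =
    (\<Sum>T\<in>Pow S. (y0 + y1 * z) ^ card T *
      (\<Sum>d | d \<in> signed_words (S - T) \<and> desarrangement d. z ^ neg d))"
proof -
  let ?g = "\<lambda>w. y1 ^ pix_minus w * y0 ^ pix_plus w * z ^ neg w"
  let ?D = "\<lambda>T. {d. d \<in> signed_words (S - T) \<and> desarrangement d}"
  have "(\<Sum>N\<in>Pow T. \<Sum>d\<in>?D T. ?g (increasing_word T N @ d)) =
      (y0 + y1 * z) ^ card T * (\<Sum>d\<in>?D T. z ^ neg d)" if "T \<in> Pow S" for T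
  proof -
    have T: "finite T" "T \<subseteq> {0<..}" using that S finite_subset by auto
    have "?g (increasing_word T N @ d) = ((y1 * z) ^ card N * y0 ^ card (T - N)) * z ^ neg d"
      if "N \<in> Pow T" "d \<in> ?D T" for N d
    proof -
      have N: "N \<subseteq> T" and d: "desarrangement d" using that by auto
      let ?u = "increasing_word T N"
      have "pixed_factorization (?u @ d) = (filter (\<lambda>x. x < 0) ?u, filter (\<lambda>x. x > 0) ?u, d)"
        using sorted_increasing_word[OF T N] zero_not_in_increasing_word[OF T N] d
        by (rule pixed_factorization_eq)
      then have "pix_minus (?u @ d) = card N" "pix_plus (?u @ d) = card (T - N)"
        using negative_increasing_word[OF T N] positive_increasing_word[OF T N]
        by (simp_all add: pix_minus_def pix_plus_def)
      moreover have "neg (?u @ d) = card N + neg d"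
        using negative_increasing_word[OF T N] by (simp add: neg_def)
      ultimately show ?thesis by (simp add: power_add power_mult_distrib mult_ac)
    qed
    then have "(\<Sum>N\<in>Pow T. \<Sum>d\<in>?D T. ?g (increasing_word T N @ d)) =
        (\<Sum>N\<in>Pow T. \<Sum>d\<in>?D T. ((y1 * z) ^ card N * y0 ^ card (T - N)) * z ^ neg d)"
      by (intro sum.cong refl) blast
    also have "\<dots> = (\<Sum>N\<in>Pow T. (y1 * z) ^ card N * y0 ^ card (T - N)) * (\<Sum>d\<in>?D T. z ^ neg d)"
      by (rule sum_product[symmetric])
    also have "(\<Sum>N\<in>Pow T. (y1 * z) ^ card N * y0 ^ card (T - N)) = (y0 + y1 * z) ^ card T"
      using sum_Pow_power_card[OF T(1), of "y1 * z" y0] by (simp only: add.commute)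
    finally show ?thesis .
  qed
  then show ?thesis
    unfolding sum_signed_words_by_pixed_factorization[OF S] by (intro sum.cong refl) blast
qed

lemma sum_pix_gen_fun:
  fixes y0 y1 z :: "'a::field_char_0"
  shows "(\<Sum>w\<in>signed_perms n. y1 ^ pix_minus w * y0 ^ pix_plus w * z ^ neg w) =
    fact n * (inverse (1 - fps_X * fps_const (1 + z)) *
      (fps_exp (y0 + y1 * z) / fps_exp (1 + z))) $ n"
proof -
  let ?S = "{1..int n}"
  let ?E = "\<lambda>R. \<Sum>d | d \<in> signed_words R \<and> desarrangement d. z ^ neg d"
  have S: "finite ?S" "?S \<subseteq> {0<..}" by auto
  \<comment> \<open>For \<open>y0 = y1 = 1\<close> only \<open>neg\<close> is left, and the sum over
    all signed words is known; this is the condition that determines \<open>?E\<close>.\<close>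
  have "(\<Sum>T\<in>Pow S. (1 + z) ^ card T * ?E (S - T)) = fact (card S) * (1 + z) ^ card S"
    if "finite S" "S \<subseteq> {0<..}" for S
    using sum_pix_by_pixed_factorization[OF that, of 1 1 z] sum_signed_words_neg[OF that, of z]
    by simp
  then have "(\<Sum>T\<in>Pow ?S. (y0 + y1 * z) ^ card T * ?E (?S - T)) =
      fact (card ?S) * (inverse (1 - fps_X * fps_const (1 + z)) *
        (fps_exp (y0 + y1 * z) / fps_exp (1 + z))) $ card ?S"
    by (rule Pow_convolution_gen_fun[OF S])
  then show ?thesis
    unfolding signed_perms_eq sum_pix_by_pixed_factorization[OF S] by simp
qed

theorem theorem1p1:
  fixes B :: "nat \<Rightarrow> poly3"
  assumes "Abs_fps (\<lambda>n. to_fract (B n) / fact n) = gen_fun"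
  shows "\<forall>n.
    B n = (\<Sum>w\<in>signed_perms n. var_Y1 ^ fix_minus w * var_Y0 ^ fix_plus w * var_Z ^ neg w) \<and>
    (\<Sum>w\<in>signed_perms n. var_Y1 ^ fix_minus w * var_Y0 ^ fix_plus w * var_Z ^ neg w) =
    (\<Sum>w\<in>signed_perms n. var_Y1 ^ pix_minus w * var_Y0 ^ pix_plus w * var_Z ^ neg w)"
proof
  fix n
  let ?F = "\<Sum>w\<in>signed_perms n. var_Y1 ^ fix_minus w * var_Y0 ^ fix_plus w * var_Z ^ neg w"
  let ?P = "\<Sum>w\<in>signed_perms n. var_Y1 ^ pix_minus w * var_Y0 ^ pix_plus w * var_Z ^ neg w"
  \<comment> \<open>The three polynomials are compared in the field of fractions, where the series
    lives; injectivity of \<open>to_fract\<close> brings the equalities back.\<close>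
  have B: "to_fract (B n) = fact n * gen_fun $ n"
    by (simp flip: assms)
  have F: "to_fract ?F = fact n * gen_fun $ n"
    by (simp add: sum_fix_gen_fun gen_fun_def to_fract_sum to_fract_power)
  have P: "to_fract ?P = fact n * gen_fun $ n"
    by (simp add: sum_pix_gen_fun gen_fun_def to_fract_sum to_fract_power)
  show "B n = ?F \<and> ?F = ?P"
    using trans[OF B F[symmetric]] trans[OF F P[symmetric]] unfolding to_fract_eq_iff by (rule conjI)
qed

end
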